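(* For every integer $n\geqslant 2$, \[ \frac{1}{n}\sum_{k\leqslant n}\Omega(k)-\log\log n\;\geqslant\;\frac{8}{7}-\log\log 7, \] with the best possible constant, equality holding only for $n=7$.
   Context: $\Omega(k)$ denotes the total number of prime divisors of the positive integer $k$ counted with multiplicity, i.e. $\Omega(k)=\sum_{p^\ell\| k}\ell$. *)

theory Defs
  imports Complex_Main "HOL-Computational_Algebra.Primes"
begin

definition Omega :: "nat \<Rightarrow> nat" where
  "Omega k = (\<Sum>p\<in>prime_factors k. multiplicity p k)"

end

theory Submission
  imports Defs "HOL-Analysis.Harmonic_Numbers" "HOL-Number_Theory.Prime_Powers"
begin

text \<open>
  Write $\sum_{k \le n} \Omega(k) = \sum_{q \le n} \lfloor n/q \rfloor$ with $q$ ranging over prime powers.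
  For $q > 32$ replace the weight $1$ by $\Lambda(q) / \ln q$ and sum by parts against
  $A(m) = \sum_{q \le m} \Lambda(q) \lfloor n/q \rfloor$. Since $A(n) = \ln n!$ and
  $\ln m! \ge m (\ln(m+1) - 1)$, one has $A(m) \ge n (\ln(m+1) - 1) - m \ln m$ for $m < n$. The
  main term telescopes to $n \ln\ln n$, and the crude error $m \ln m$ costs only
  $(n - 32) / \ln 32$ in total. Together with the prime powers $q \le 13$ and $16, 25, 27, 32$ this
  already gives the strict inequality for all $n \ge 32$; the remaining $n$ are checked
  individually.
\<close>

section \<open>Divisor sums for \<open>Omega\<close> and the von Mangoldt function\<close>

text \<open>Passing from \<open>n\<close> to \<open>Suc n\<close> raises \<open>n div d\<close> by
  one exactly when \<open>d\<close> divides \<open>Suc n\<close>.\<close>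

lemma sum_divisors_upto:
  fixes f :: "nat \<Rightarrow> 'a :: comm_semiring_1"
  shows "(\<Sum>k=1..n. \<Sum>d | d dvd k. f d) = (\<Sum>d=1..n. of_nat (n div d) * f d)"
proof (induction n)
  case (Suc n)
  have "(\<Sum>d=1..Suc n. of_nat (Suc n div d) * f d)
      = (\<Sum>d=1..Suc n. of_nat (n div d) * f d + (if d dvd Suc n then f d else 0))"
    by (intro sum.cong refl) (auto simp: div_Suc mod_eq_0_iff_dvd algebra_simps)
  also have "\<dots> = (\<Sum>d=1..n. of_nat (n div d) * f d) + (\<Sum>d | d dvd Suc n. f d)"
  proof -
    have "(\<Sum>d=1..Suc n. if d dvd Suc n then f d else 0) = (\<Sum>d | d dvd Suc n. f d)"
      by (subst sum.inter_filter [symmetric])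
         (auto intro!: sum.cong Nat.gr0I dest: dvd_imp_le simp: Suc_le_eq)
    thus ?thesis by (simp add: sum.distrib)
  qed
  finally show ?case using Suc by simp
qed simp

lemma Omega_eq_size: "Omega k = size (prime_factorization k)"
  unfolding Omega_def size_multiset_overloaded_eq
  by (intro sum.cong) (auto simp: count_prime_factorization_prime in_prime_factors_imp_prime)

lemma Omega_prime_mult:
  assumes "prime p" "0 < m"
  shows "Omega (p * m) = Suc (Omega m)"
  using assms prime_gt_0_nat
  by (simp add: Omega_eq_size prime_factorization_mult prime_factorization_prime)

lemma Omega_prime: "prime p \<Longrightarrow> Omega p = 1"
  by (simp add: Omega_eq_size prime_factorization_prime)

lemma Omega_one [simp]: "Omega (Suc 0) = 0"
  by (simp add: Omega_eq_size)

text \<open>A prime of multiplicity \<open>l\<close> in \<open>k\<close> accounts for exactly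
  \<open>l\<close> prime-power divisors of \<open>k\<close>, namely its powers with exponents 1 to
  \<open>l\<close>.\<close>

lemma Omega_conv_sum_divisors:
  assumes "k > 0"
  shows "real (Omega k) = (\<Sum>d | d dvd k. of_bool (primepow d))"
proof -
  have "Omega k = card (primepow_factors k)"
    using sum_prime_factorization_conv_sum_primepow_factors[of k "\<lambda>_. 1::nat"] assms
    by (simp add: Omega_eq_size)
  also have "real \<dots> = (\<Sum>d | d dvd k. of_bool (primepow d))"
    using assms by (auto simp: primepow_factors_def sum.If_cases Collect_conj_eq Int_commute)
  finally show ?thesis .
qed

lemma sum_Omega:
  "(\<Sum>k=1..n. real (Omega k)) = (\<Sum>d=1..n. real (n div d) * of_bool (primepow d))"
proof -
  have "(\<Sum>k=1..n. real (Omega k)) = (\<Sum>k=1..n. \<Sum>d | d dvd k. of_bool (primepow d))"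
    by (intro sum.cong refl Omega_conv_sum_divisors) auto
  thus ?thesis by (simp only: sum_divisors_upto)
qed

lemma sum_mangoldt_div:
  "(\<Sum>d=1..n. real (n div d) * mangoldt d) = ln (fact n)"
proof -
  have "ln (fact n :: real) = (\<Sum>k=1..n. ln (real k))"
    by (simp add: fact_prod, subst ln_prod) auto
  also have "\<dots> = (\<Sum>k=1..n. \<Sum>d | d dvd k. mangoldt d)"
    by (intro sum.cong refl) (simp add: mangoldt_sum)
  finally show ?thesis by (simp only: sum_divisors_upto)
qed

section \<open>Chebyshev-Mertens type lower bounds\<close>

lemma mult_ln_increment_le:
  fixes x :: real
  assumes "x \<ge> 1"
  shows "x * (ln (x + 1) - ln x) \<le> 1"
  using ln_diff_le_inverse[OF assms] assms by (simp add: less_divide_eq mult.commute)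

text \<open>The induction step amounts to \<open>mult_ln_increment_le\<close> at
  \<open>n + 1\<close>.\<close>

lemma ln_fact_ge: "ln (fact n :: real) \<ge> real n * (ln (real n + 1) - 1)"
proof (induction n)
  case (Suc n)
  have "(real n + 1) * (ln (real n + 2) - ln (real n + 1)) \<le> 1"
    using mult_ln_increment_le[of "real n + 1"] by (simp add: add.assoc)
  moreover have "ln (fact (Suc n) :: real) = ln (real n + 1) + ln (fact n)"
    by (simp add: ln_mult add.commute)
  ultimately show ?case using Suc.IH by (simp add: algebra_simps)
qed simp

text \<open>With \<open>k = d\<close> this replaces weights beyond the cutoff; with \<open>k\<close>
  the cutoff it makes the reduced weights below it nonnegative.\<close>

lemma mangoldt_le_primepow:
  assumes "0 < d" "d \<le> k" "1 < k"
  shows "mangoldt d / ln (real k) \<le> of_bool (primepow d)"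
proof -
  have "mangoldt d \<le> ln (real d)" using mangoldt_le assms by simp
  also have "\<dots> \<le> ln (real k)" using assms by simp
  finally show ?thesis using assms by (cases "primepow d") (simp_all add: mangoldt_def del: ln_le_cancel_iff)
qed

text \<open>Dropping the floors in the identity for \<open>ln (fact m)\<close> and dividing by
  \<open>m\<close> gives this half of Mertens' estimate.\<close>

lemma sum_mangoldt_over_ge:
  assumes "m > 0"
  shows "(\<Sum>d=1..m. mangoldt d / real d) \<ge> ln (real m + 1) - 1"
proof -
  have "real m * (ln (real m + 1) - 1) \<le> (\<Sum>d=1..m. real (m div d) * mangoldt d)"
    using ln_fact_ge sum_mangoldt_div by simp
  also have "\<dots> \<le> (\<Sum>d=1..m. real m / real d * mangoldt d)"
    by (intro sum_mono mult_right_mono of_nat_div_le_of_nat mangoldt_nonneg)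
  also have "\<dots> = real m * (\<Sum>d=1..m. mangoldt d / real d)"
    by (simp add: sum_distrib_left)
  finally show ?thesis using assms by simp
qed

text \<open>Each floor loses at most 1, so the total loss is at most the Chebyshev sum of
  \<open>mangoldt d\<close> over \<open>d \<le> m\<close>, bounded trivially by
  \<open>m * ln m\<close>.\<close>

lemma sum_div_mangoldt_ge:
  assumes "m > 0"
  shows "(\<Sum>d=1..m. real (n div d) * mangoldt d) \<ge> real n * (ln (real m + 1) - 1) - real m * ln (real m)"
proof -
  have "real n * (ln (real m + 1) - 1) - real m * ln (real m)
      \<le> real n * (\<Sum>d=1..m. mangoldt d / real d) - (\<Sum>d=1..m. mangoldt d)"
  proof (intro diff_mono mult_left_mono sum_mangoldt_over_ge assms)
    have "(\<Sum>d=1..m. mangoldt d) \<le> (\<Sum>d=1..m. ln (real m))"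
    proof (intro sum_mono)
      fix d assume "d \<in> {1..m}"
      thus "mangoldt d \<le> ln (real m)" using mangoldt_le[of d] by (force intro: order.trans)
    qed
    thus "(\<Sum>d=1..m. mangoldt d) \<le> real m * ln (real m)" by simp
  qed simp
  also have "\<dots> = (\<Sum>d=1..m. (real n / real d - 1) * mangoldt d)"
    by (simp add: sum_distrib_left sum_subtractf algebra_simps)
  also have "\<dots> \<le> (\<Sum>d=1..m. real (n div d) * mangoldt d)"
  proof (intro sum_mono mult_right_mono mangoldt_nonneg)
    fix d
    show "real n / real d - 1 \<le> real (n div d)"
      using floor_correct[of "real n / real d"] by (simp add: floor_divide_of_nat_eq)
  qed
  finally show ?thesis .
qed

section \<open>Partial summation against \<open>1 / ln\<close>\<close>

lemma sum_over_ln_by_parts: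
  fixes a :: "nat \<Rightarrow> real"
  assumes "1 \<le> k" "k \<le> N"
  defines "A \<equiv> \<lambda>m. \<Sum>d=1..m. a d"
  shows "(\<Sum>d=Suc k..N. a d / ln (real d)) =
           A N / ln (real N) - A k / ln (real k)
           + (\<Sum>m=k..<N. A m * (1 / ln (real m) - 1 / ln (real m + 1)))"
  using assms(2)
proof (induction N rule: dec_induct)
  case (step N)
  have "A (Suc N) = A N + a (Suc N)" by (simp add: A_def)
  with step show ?case
    by (simp add: add_divide_distrib algebra_simps)
qed simp

text \<open>With $u = \ln m$ and $v = \ln (m+1)$ this is $v/u - 1 \geq \ln (v/u)$, up to the telescoping $1/u$ and $1/v$.\<close>
lemma ln_ln_increment_le:
  fixes u v :: real
  assumes "0 < u" "0 < v"
  shows "ln v - ln u - 1 / u + 1 / v \<le> (v - 1) * (1 / u - 1 / v)"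
proof -
  have "ln v - ln u \<le> v / u - 1"
    using ln_le_minus_one[of "v / u"] assms by (simp add: ln_div)
  moreover have "(v - 1) * (1 / u - 1 / v) = v / u - 1 - 1 / u + 1 / v"
    using assms by (simp add: field_simps)
  ultimately show ?thesis by linarith
qed

text \<open>The factor \<open>ln m\<close> cancels against the difference of reciprocals, leaving
  \<open>m * (ln (m + 1) - ln m) / ln (m + 1)\<close>, whose numerator is at most 1.\<close>

lemma ln_increment_loss_le:
  assumes "1 < k" "k \<le> m"
  shows "real m * ln (real m) * (1 / ln (real m) - 1 / ln (real m + 1)) \<le> 1 / ln (real k)"
proof -
  have pos: "0 < ln (real k)" "ln (real k) \<le> ln (real m + 1)" "0 < ln (real m)"
    using assms by auto
  have *: "real m * (ln (real m + 1) - ln (real m)) \<le> 1"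
    using assms by (intro mult_ln_increment_le) auto
  have "real m * ln (real m) * (1 / ln (real m) - 1 / ln (real m + 1)) 
      = real m * (ln (real m + 1) - ln (real m)) / ln (real m + 1)"
  proof -
    have eq: "a * u * (1 / u - 1 / v) = a * (v - u) / v" if "0 < u" "0 < v" for a u v :: real
      using that by (simp add: field_simps)
    show ?thesis using pos by (intro eq) linarith+
  qed
  also have "\<dots> \<le> 1 / ln (real k)"
    using * pos by (intro frac_le) auto
  finally show ?thesis .
qed

text \<open>Each summand dominates \<open>n\<close> times an increment of
  \<open>ln (ln m) + 1 / ln m\<close>, up to a loss of \<open>1 / ln k\<close>. The increments
  telescope and the loss occurs \<open>n - k\<close> times.\<close>

lemma sum_over_ln_ge:
  assumes "1 < k" "k \<le> n"
  shows "(\<Sum>m=k..<n. (real n * (ln (real m + 1) - 1) - real m * ln (real m))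
             * (1 / ln (real m) - 1 / ln (real m + 1)))
      \<ge> real n * (ln (ln (real n)) - ln (ln (real k)) - 1 / ln (real k) + 1 / ln (real n))
         - (real n - real k) / ln (real k)"
proof -
  define h where "h = (\<lambda>m. ln (ln (real m)) + 1 / ln (real m))"
  have "real n * (h n - h k) - (real n - real k) / ln (real k)
      = (\<Sum>m=k..<n. real n * (h (Suc m) - h m) - 1 / ln (real k))"
    using assms(2) sum_Suc_diff'[of k n h]
    by (simp only: sum_subtractf sum_distrib_left [symmetric]) (simp add: of_nat_diff)
  also have "\<dots> \<le> (\<Sum>m=k..<n. (real n * (ln (real m + 1) - 1) - real m * ln (real m))
             * (1 / ln (real m) - 1 / ln (real m + 1)))"
  proof (intro sum_mono)
    fix m assume m: "m \<in> {k..<n}"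
    have "h (Suc m) - h m \<le> (ln (real m + 1) - 1) * (1 / ln (real m) - 1 / ln (real m + 1))"
      using ln_ln_increment_le[of "ln (real m)" "ln (real m + 1)"] m assms
      by (simp add: h_def add.commute)
    hence "real n * (h (Suc m) - h m)
        \<le> real n * (ln (real m + 1) - 1) * (1 / ln (real m) - 1 / ln (real m + 1))"
      unfolding mult.assoc by (intro mult_left_mono) auto
    moreover have "real m * ln (real m) * (1 / ln (real m) - 1 / ln (real m + 1)) \<le> 1 / ln (real k)"
      using m assms by (intro ln_increment_loss_le) auto
    ultimately show "real n * (h (Suc m) - h m) - 1 / ln (real k)
        \<le> (real n * (ln (real m + 1) - 1) - real m * ln (real m))
             * (1 / ln (real m) - 1 / ln (real m + 1))"
      unfolding left_diff_distrib[of "real n * (ln (real m + 1) - 1)"] by linarith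
  qed
  finally show ?thesis by (simp add: h_def algebra_simps)
qed

text \<open>Prime powers $d \le k$ are kept with their weight reduced by $\Lambda(d)/\ln k$, the boundary term of the partial summation.\<close>
lemma sum_Omega_ge:
  assumes "1 < k" "k \<le> n"
  shows "(\<Sum>j=1..n. real (Omega j)) \<ge>
           (\<Sum>d=1..k. real (n div d) * (of_bool (primepow d) - mangoldt d / ln (real k)))
           + real n * (1 + ln (ln (real n)) - ln (ln (real k)) - 1 / ln (real k))
           - (real n - real k) / ln (real k)"
proof -
  define a where "a = (\<lambda>d. real (n div d) * mangoldt d)"
  define A where "A = (\<lambda>m. \<Sum>d=1..m. a d)"
  define w where "w = (\<lambda>d. real (n div d) * of_bool (primepow d))"
  have pos: "0 < ln (real k)" "0 < ln (real n)" using assms by auto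
  \<comment> \<open>The endpoint uses the exact value \<open>A n = ln (fact n)\<close>, avoiding the
    error \<open>n * ln n\<close>. The deficit \<open>1 / ln n\<close> later cancels the
    \<open>1 / ln n\<close> supplied by \<open>sum_over_ln_ge\<close>.\<close>
  have "A n / ln (real n) \<ge> real n * (ln (real n) - 1) / ln (real n)"
  proof (intro divide_right_mono)
    have "real n * (ln (real n) - 1) \<le> real n * (ln (real n + 1) - 1)"
      using assms by (intro mult_left_mono) auto
    also have "\<dots> \<le> A n" using ln_fact_ge[of n] sum_mangoldt_div[of n] by (simp add: A_def a_def)
    finally show "real n * (ln (real n) - 1) \<le> A n" .
  qed (use pos in auto)
  also have "real n * (ln (real n) - 1) / ln (real n) = real n * (1 - 1 / ln (real n))"
    using pos by (simp add: field_simps)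
  finally have last: "real n * (1 - 1 / ln (real n)) \<le> A n / ln (real n)" .
  have "real n * (ln (ln (real n)) - ln (ln (real k)) - 1 / ln (real k) + 1 / ln (real n))
         - (real n - real k) / ln (real k) \<le> (\<Sum>m=k..<n. A m * (1 / ln (real m) - 1 / ln (real m + 1)))"
  proof (rule order.trans[OF sum_over_ln_ge[OF assms]], intro sum_mono mult_right_mono)
    fix m assume m: "m \<in> {k..<n}"
    thus "real n * (ln (real m + 1) - 1) - real m * ln (real m) \<le> A m"
      using sum_div_mangoldt_ge[of m n] assms by (simp add: A_def a_def)
    show "0 \<le> 1 / ln (real m) - 1 / ln (real m + 1)"
      using m assms by (simp add: frac_le)
  qed
  with last have "real n * (1 + ln (ln (real n)) - ln (ln (real k)) - 1 / ln (real k))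
         - (real n - real k) / ln (real k) \<le> A k / ln (real k) + (\<Sum>d=Suc k..n. a d / ln (real d))"
    using sum_over_ln_by_parts[of k n a] assms by (simp add: A_def algebra_simps)
  also have "(\<Sum>d=Suc k..n. a d / ln (real d)) \<le> (\<Sum>d=Suc k..n. w d)"
  proof (intro sum_mono)
    fix d assume "d \<in> {Suc k..n}"
    with assms have "mangoldt d / ln (real d) \<le> of_bool (primepow d)"
      by (intro mangoldt_le_primepow) auto
    thus "a d / ln (real d) \<le> w d"
      unfolding a_def w_def times_divide_eq_right [symmetric] by (intro mult_left_mono) auto
  qed
  also have "(\<Sum>d=Suc k..n. w d) = (\<Sum>d=1..n. w d) - (\<Sum>d=1..k. w d)"
    using assms sum.ub_add_nat[of 1 k w "n - k"] by simp
  finally show ?thesis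
    unfolding sum_Omega w_def a_def A_def
    by (simp add: sum_subtractf sum_divide_distrib algebra_simps)
qed

section \<open>Explicit estimates with cutoff 32\<close>

lemma ln_le_ratio_mult_ln:
  assumes "0 < b" "0 < x" "x ^ b \<le> y ^ a"
  shows "ln (real x) \<le> real a / real b * ln (real y)"
proof -
  have "0 < y ^ a" using assms by (meson less_le_trans zero_less_power)
  have "real b * ln (real x) = ln (real (x ^ b))"
    using assms by (simp add: ln_realpow)
  also have "\<dots> \<le> ln (real (y ^ a))"
    using assms \<open>0 < y ^ a\<close> by (subst ln_le_cancel_iff) (simp_all del: of_nat_power)
  also have "\<dots> = real a * ln (real y)"
    using \<open>0 < y ^ a\<close> by (cases "a = 0") (auto simp: ln_realpow)
  finally show ?thesis using assms by (simp add: field_simps)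
qed

text \<open>Here $a/b$ is a rational upper bound for $\log_2 p$, and $32 = 2^5$.\<close>
lemma primepow_term_ge:
  assumes "prime p" "0 < k" "0 < b" "p ^ b \<le> 2 ^ a" "a \<le> 5 * b"
  shows "(1 - real a / (5 * real b)) * ((real n + 1) / real (p ^ k) - 1)
           \<le> real (n div p ^ k) * (of_bool (primepow (p ^ k)) - mangoldt (p ^ k) / ln 32)"
proof -
  have pk: "p ^ k > 0" using assms prime_gt_0_nat by simp
  \<comment> \<open>Integrality sharpens the strict bound on \<open>n\<close> to one on
    \<open>n + 1\<close>.\<close>
  have "real n + 1 \<le> real (p ^ k) * (real (n div p ^ k) + 1)"
  proof -
    have "n + 1 \<le> p ^ k * (n div p ^ k + 1)"
      using pk by (metis Suc_eq_plus1 Suc_leI dividend_less_times_div mult_Suc_right add.commute)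
    hence "real (n + 1) \<le> real (p ^ k * (n div p ^ k + 1))" by (simp only: of_nat_le_iff)
    thus ?thesis by (simp add: algebra_simps)
  qed
  hence 1: "(real n + 1) / real (p ^ k) - 1 \<le> real (n div p ^ k)"
    using pk by (simp add: field_simps del: of_nat_power)
  have "ln (real p) \<le> real a / real b * ln 2"
    using ln_le_ratio_mult_ln[of b p 2 a] assms prime_gt_0_nat by simp
  moreover have "ln (32 :: real) = 5 * ln 2"
    using ln_realpow[of "2::real" 5] by simp
  ultimately have "ln (real p) / ln 32 \<le> real a / (5 * real b)"
    using assms(3) by (simp add: field_simps)
  hence 2: "1 - real a / (5 * real b) \<le> of_bool (primepow (p ^ k)) - mangoldt (p ^ k) / ln 32"
    using assms by simp
  have "(1 - real a / (5 * real b)) * ((real n + 1) / real (p ^ k) - 1)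
      \<le> (1 - real a / (5 * real b)) * real (n div p ^ k)"
    using assms 1 by (intro mult_left_mono) auto
  also have "\<dots> \<le> (of_bool (primepow (p ^ k)) - mangoldt (p ^ k) / ln 32) * real (n div p ^ k)"
    using 2 by (intro mult_right_mono) auto
  finally show ?thesis by (simp add: mult.commute)
qed

lemma sum_primepow_terms_ge:
  "(\<Sum>d=1..32. real (n div d) * (of_bool (primepow d) - mangoldt d / ln 32))
     \<ge> 1338 / 1000 * (real n + 1) - 81 / 10"
proof -
  define f where "f = (\<lambda>d. real (n div d) * (of_bool (primepow d) - mangoldt d / ln 32))"
  have f: "(1 - real a / (5 * real b)) * ((real n + 1) / real (p ^ k) - 1) \<le> f (p ^ k)"
    if "prime p" "0 < k" "0 < b" "p ^ b \<le> 2 ^ a" "a \<le> 5 * b" for p k a b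
    using primepow_term_ge[OF that] by (simp add: f_def)
  have f2: "4 / 5 * ((real n + 1) / 2 - 1) \<le> f 2"
    using f[of 2 1 1 1] by simp
  have f4: "4 / 5 * ((real n + 1) / 4 - 1) \<le> f 4"
    using f[of 2 2 1 1] by simp
  have f8: "4 / 5 * ((real n + 1) / 8 - 1) \<le> f 8"
    using f[of 2 3 1 1] by simp
  have f16: "4 / 5 * ((real n + 1) / 16 - 1) \<le> f 16"
    using f[of 2 4 1 1] by simp
  have f32: "4 / 5 * ((real n + 1) / 32 - 1) \<le> f 32"
    using f[of 2 5 1 1] by simp
  \<comment> \<open>From \<open>3 ^ 5 \<le> 2 ^ 8\<close> the weight is \<open>1 - 8 / 25\<close>;
    the weights for 5, 7, 11 and 13 arise likewise.\<close>
  have f3: "17 / 25 * ((real n + 1) / 3 - 1) \<le> f 3"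
    using f[of 3 1 5 8] by simp
  have f9: "17 / 25 * ((real n + 1) / 9 - 1) \<le> f 9"
    using f[of 3 2 5 8] by simp
  have f27: "17 / 25 * ((real n + 1) / 27 - 1) \<le> f 27"
    using f[of 3 3 5 8] by simp
  have f5: "8 / 15 * ((real n + 1) / 5 - 1) \<le> f 5"
    using f[of 5 1 3 7] by simp
  have f25: "8 / 15 * ((real n + 1) / 25 - 1) \<le> f 25"
    using f[of 5 2 3 7] by simp
  have f7: "13 / 30 * ((real n + 1) / 7 - 1) \<le> f 7"
    using f[of 7 1 6 17] by simp
  have f11: "3 / 10 * ((real n + 1) / 11 - 1) \<le> f 11"
    using f[of 11 1 2 7] by simp
  have f13: "1 / 4 * ((real n + 1) / 13 - 1) \<le> f 13"
    using f[of 13 1 4 15] by simp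
  \<comment> \<open>The exact coefficient of \<open>n + 1\<close> is 1.3388..., and the subtracted
    weights sum to 8.09.\<close>
  have "1338 / 1000 * (real n + 1) - 81 / 10 \<le> (\<Sum>d\<in>{2, 4, 8, 16, 32, 3, 9, 27, 5, 25, 7, 11, 13}. f d)"
    using f2 f4 f8 f16 f32 f3 f9 f27 f5 f25 f7 f11 f13 of_nat_0_le_iff[of n, where ?'a = real]
    by (simp add: add_divide_distrib)
  also have "\<dots> \<le> (\<Sum>d=1..32. f d)"
  proof (rule sum_mono2)
    fix d :: nat assume "d \<in> {1..32} - {2, 4, 8, 16, 32, 3, 9, 27, 5, 25, 7, 11, 13}"
    thus "0 \<le> f d" using mangoldt_le_primepow[of d 32] by (simp add: f_def)
  qed auto
  finally show ?thesis by (simp add: f_def)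
qed

lemma ln_32_ge: "ln (32 :: real) \<ge> 10 / 3"
  using ln2_ge_two_thirds ln_realpow[of "2::real" 5] by simp

text \<open>The difference is the logarithm of \<open>ln 32 / ln 7\<close>, which is at most
  \<open>25 / 14\<close> because \<open>2 ^ 14 \<le> 7 ^ 5\<close>.\<close>

lemma ln_ln_32_minus_ln_ln_7_le: "ln (ln (32 :: real)) - ln (ln 7) \<le> 59 / 100"
proof -
  have "ln (32 :: real) = 5 * ln 2"
    using ln_realpow[of "2::real" 5] by simp
  moreover have "ln (2 :: real) \<le> 5 / 14 * ln 7"
    using ln_le_ratio_mult_ln[of 14 2 7 5] by simp
  ultimately have "ln (ln (32 :: real)) \<le> ln (25 / 14 * ln 7)"
    by (subst ln_le_cancel_iff) auto
  also have "\<dots> = ln (25 / 14) + ln (ln 7)" by (rule ln_mult_pos) auto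
  also have "ln (25 / 14 :: real) \<le> 59 / 100"
  proof -
    \<comment> \<open>Halving the argument and squaring is needed: the quadratic Taylor polynomial
      at \<open>59 / 100\<close> is only about 1.764, below \<open>25 / 14\<close>.\<close>
    have "25 / 14 \<le> (1 + 59 / 200 + (59 / 200)\<^sup>2 / 2 :: real) ^ 2" by (simp add: power2_eq_square)
    also have "\<dots> \<le> exp (59 / 200) ^ 2"
      by (intro power_mono exp_lower_Taylor_quadratic) auto
    also have "\<dots> = exp (59 / 100)" by (simp add: exp_of_nat_mult [symmetric])
    finally show ?thesis by (metis ln_exp ln_le_cancel_iff exp_gt_zero zero_less_divide_iff zero_less_numeral)
  qed
  finally show ?thesis by simp
qed

lemma sum_Omega_gt_large:
  assumes "n \<ge> 32"
  shows "(\<Sum>k=1..n. real (Omega k)) > real n * (8 / 7 - ln (ln 7) + ln (ln (real n)))"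
proof -
  define y where "y = 1 / ln (32 :: real)"
  have "y \<le> 3 / 10" using ln_32_ge by (simp add: y_def field_simps)
  \<comment> \<open>The factor collects the boundary loss \<open>n * y\<close> and the summation
    loss \<open>(n - 32) * y\<close>.\<close>
  hence y: "(2 * real n - 32) * y \<le> (2 * real n - 32) * (3 / 10)"
    using assms by (intro mult_left_mono) auto
  have L: "real n * (ln (ln 32) - ln (ln 7)) \<le> real n * (59 / 100)"
    using ln_ln_32_minus_ln_ln_7_le by (intro mult_left_mono) auto
  have "(\<Sum>k=1..n. real (Omega k)) \<ge> 1338 / 1000 * (real n + 1) - 81 / 10
      + real n * (1 + ln (ln (real n)) - ln (ln 32) - y) - (real n - 32) * y"
    using sum_Omega_ge[of 32 n] sum_primepow_terms_ge[of n] assms by (simp add: y_def)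
  moreover have "real n \<ge> 32" using assms by simp
  \<comment> \<open>The remaining margin is \<open>(2.338 - 8/7 - 0.59 - 0.6) * n + 2.838\<close>,
    whose leading coefficient is about 0.005.\<close>
  ultimately show ?thesis using y L unfolding ring_distribs by linarith
qed

section \<open>Numerical verification below 32\<close>

lemma sum_Omega_conv_sum_list: "(\<Sum>k=1..n. Omega k) = sum_list (map Omega [2..<Suc n])"
proof -
  have "(\<Sum>k=1..n. Omega k) = (\<Sum>k\<in>{2..<Suc n}. Omega k)"
    by (rule sum.mono_neutral_right) (auto simp: not_le less_Suc_eq numeral_2_eq_2)
  thus ?thesis by (simp add: interv_sum_list_conv_sum_set_nat del: upt_Suc)
qed

text \<open>
  With $r = \frac1n \sum_{k \le n} \Omega(k) - \frac87$ the claim is $\ln n / \ln 7 < e^r$, which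
  follows from $\ln n / \ln 7 < a/b \le (1 + r/2)^2 \le e^r$.
\<close>
lemma sum_Omega_gt_smallI:
  fixes a b n :: nat
  defines "s \<equiv> \<Sum>k=1..n. Omega k"
  assumes "2 \<le> n" "0 < b" "n ^ b < 7 ^ a"
    and "real a / real b \<le> (1 + (real s / real n - 8 / 7) / 2)\<^sup>2"
  shows "(\<Sum>k=1..n. real (Omega k)) > real n * (8 / 7 - ln (ln 7) + ln (ln (real n)))"
proof -
  let ?r = "real s / real n - 8 / 7"
  have "real b * ln (real n) < real a * ln 7"
  proof -
    have "real (n ^ b) < real (7 ^ a)" using assms(4) by (simp only: of_nat_less_iff)
    hence "ln (real n ^ b) < ln (7 ^ a)" using assms(2) by (subst ln_less_cancel_iff) auto
    thus ?thesis using assms(2) by (simp add: ln_realpow)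
  qed
  hence "ln (real n) / ln 7 < real a / real b"
    using assms(3) by (simp add: field_simps)
  also have "real a / real b \<le> (1 + ?r / 2)\<^sup>2" by fact
  also have "\<dots> \<le> exp ?r"
  proof -
    have "0 \<le> real s / real n" by simp
    \<comment> \<open>This keeps \<open>1 + ?r / 2\<close> nonnegative, as the square bound for
      \<open>exp\<close> requires.\<close>
    hence "- 2 \<le> ?r" by linarith
    thus ?thesis using exp_ge_one_plus_x_over_n_power_n[of 2 ?r] by simp
  qed
  finally have "ln (ln (real n) / ln 7) < ln (exp ?r)"
    using assms(2) by (subst ln_less_cancel_iff) auto
  hence "ln (ln (real n)) - ln (ln 7) < ?r"
    using assms(2) by (simp add: ln_div)
  hence "real n * (8 / 7 - ln (ln 7) + ln (ln (real n))) < real s"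
    using assms(2) by (simp add: field_simps)
  thus ?thesis by (simp add: s_def)
qed

text \<open>Peeling off the smallest prime factor reduces each value to a smaller argument, ending
  at a prime.\<close>

lemma Omega_composite_le_31:
  shows "Omega 4 = 2" "Omega 6 = 2" "Omega 8 = 3" "Omega 9 = 2" "Omega 10 = 2" "Omega 12 = 3"
  "Omega 14 = 2" "Omega 15 = 2" "Omega 16 = 4" "Omega 18 = 3" "Omega 20 = 3" "Omega 21 = 2"
  "Omega 22 = 2" "Omega 24 = 4" "Omega 25 = 2" "Omega 26 = 2" "Omega 27 = 3" "Omega 28 = 3"
  "Omega 30 = 3"
  using Omega_prime_mult[of 2 2] Omega_prime_mult[of 2 3] Omega_prime_mult[of 2 4]
    Omega_prime_mult[of 3 3] Omega_prime_mult[of 2 5] Omega_prime_mult[of 2 6]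
    Omega_prime_mult[of 2 7] Omega_prime_mult[of 3 5] Omega_prime_mult[of 2 8]
    Omega_prime_mult[of 2 9] Omega_prime_mult[of 2 10] Omega_prime_mult[of 3 7]
    Omega_prime_mult[of 2 11] Omega_prime_mult[of 2 12] Omega_prime_mult[of 5 5]
    Omega_prime_mult[of 2 13] Omega_prime_mult[of 3 9] Omega_prime_mult[of 2 14]
    Omega_prime_mult[of 2 15]
  by (simp_all add: Omega_prime)

lemma sum_Omega_gt_small:
  assumes "2 \<le> n" "n < 32" "n \<noteq> 7"
  shows "(\<Sum>k=1..n. real (Omega k)) > real n * (8 / 7 - ln (ln 7) + ln (ln (real n)))"
proof -
  \<comment> \<open>entries $(n, a, b)$ with $\log_7 n < a/b$\<close>
  define certs :: "(nat \<times> nat \<times> nat) list" where "certs =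
    [(2,2,5), (3,4,7), (4,3,4), (5,5,6), (6,1,1), (8,6,5), (9,5,4), (10,4,3),
     (11,4,3), (12,4,3), (13,4,3), (14,7,5), (15,3,2), (16,3,2), (17,3,2),
     (18,3,2), (19,5,3), (20,5,3), (21,5,3), (22,5,3), (23,5,3), (24,5,3),
     (25,5,3), (26,7,4), (27,7,4), (28,7,4), (29,7,4), (30,7,4), (31,9,5)]"
  have "\<forall>(n, a, b) \<in> set certs. 0 < b \<and> n ^ b < 7 ^ a \<and>
          real a / real b \<le> (1 + (real (\<Sum>k=1..n. Omega k) / real n - 8 / 7) / 2)\<^sup>2"
    unfolding certs_def sum_Omega_conv_sum_list
    by (simp add: Omega_prime Omega_composite_le_31 power2_eq_square)
  moreover have "n \<in> fst ` set certs"
    using assms by (simp add: certs_def) presburger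
  ultimately show ?thesis
    using sum_Omega_gt_smallI[OF assms(1)] by fastforce
qed

section \<open>Strict inequality away from 7, and equality at 7\<close>

lemma sum_Omega_gt:
  assumes "2 \<le> n" "n \<noteq> 7"
  shows "(1 / real n) * (\<Sum>k=1..n. real (Omega k)) - ln (ln (real n)) > 8 / 7 - ln (ln 7)"
proof -
  have "(\<Sum>k=1..n. real (Omega k)) > real n * (8 / 7 - ln (ln 7) + ln (ln (real n)))"
    using sum_Omega_gt_small[of n] sum_Omega_gt_large[of n] assms by (cases "n < 32") auto
  thus ?thesis using assms by (simp add: field_simps)
qed

lemma sum_Omega_7: "(1 / real 7) * (\<Sum>k=1..7. real (Omega k)) = 8 / 7"
proof -
  have "(\<Sum>k=1..7. Omega k) = 8"
    unfolding sum_Omega_conv_sum_list by (simp add: Omega_prime Omega_composite_le_31)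
  hence "real (\<Sum>k=1..7. Omega k) = 8" by simp
  thus ?thesis by simp
qed

theorem theorem2p2:
  shows "(\<forall>n::nat. n \<ge> 2 \<longrightarrow>
            (1 / real n) * (\<Sum>k=1..n. real (Omega k)) - ln (ln (real n)) \<ge> 8 / 7 - ln (ln 7))
       \<and> (\<forall>n::nat. n \<ge> 2 \<longrightarrow>
            ((1 / real n) * (\<Sum>k=1..n. real (Omega k)) - ln (ln (real n)) = 8 / 7 - ln (ln 7)
              \<longleftrightarrow> n = 7))
       \<and> (\<forall>c::real.
            (\<forall>n::nat. n \<ge> 2 \<longrightarrow>
               (1 / real n) * (\<Sum>k=1..n. real (Omega k)) - ln (ln (real n)) \<ge> c)
            \<longrightarrow> c \<le> 8 / 7 - ln (ln 7))"
proof (intro conjI allI impI)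
  fix n :: nat
  assume n: "n \<ge> 2"
  show "(1 / real n) * (\<Sum>k=1..n. real (Omega k)) - ln (ln (real n)) \<ge> 8 / 7 - ln (ln 7)"
    using sum_Omega_gt[OF n] sum_Omega_7 by (cases "n = 7") auto
  show "(1 / real n) * (\<Sum>k=1..n. real (Omega k)) - ln (ln (real n)) = 8 / 7 - ln (ln 7)
          \<longleftrightarrow> n = 7"
    using sum_Omega_gt[OF n] sum_Omega_7 by (cases "n = 7") auto
next
  fix c :: real
  assume "\<forall>n::nat. n \<ge> 2 \<longrightarrow>
            (1 / real n) * (\<Sum>k=1..n. real (Omega k)) - ln (ln (real n)) \<ge> c"
  \<comment> \<open>Sharpness follows because the bound is attained at 7.\<close>
  from this[rule_format, of 7] show "c \<le> 8 / 7 - ln (ln 7)"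
    using sum_Omega_7 by simp
qed

end
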